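(* Let $\mathcal{V}=(V_1,\ldots,V_n)$ be a list of linear subspaces of $\mathbb{R}^\ell$, each of dimension at most $k$, with an $(\alpha,\delta)$-system $\mathcal{S}=(S_1,\ldots,S_w)$, let $\tau>0$, and let $d=\dim(V_1+\cdots+V_n)$. If for every $j\in[w]$ and every $\{i_1,i_2\}\subseteq S_j$ the spaces $V_{i_1}$ and $V_{i_2}$ are $\tau$-separated, then $d\leq\alpha k/(\tau\delta)$.
   Context: Two subspaces $V,V'\subseteq\mathbb{R}^\ell$ are $\tau$-separated if $|\langle\vec{u},\vec{u}'\rangle|\leq1-\tau$ for all unit vectors $\vec{u}\in V$, $\vec{u}'\in V'$. A list of sets $\mathcal{S}=(S_1,\ldots,S_w)$ is an $(\alpha,\delta)$-system of $\mathcal{V}$ ($\alpha\in\mathbb{Z}^+$, $\delta>0$) if: (1) every $S_j$ is a subset of $[n]$ of size $3$ or $2$; (2) if $S_j=\{i_1,i_2,i_3\}$ then $V_{i_1}\subseteq V_{i_2}+V_{i_3}$, $V_{i_2}\subseteq V_{i_1}+V_{i_3}$, $V_{i_3}\subseteq V_{i_1}+V_{i_2}$; if $S_j=\{i_1,i_2\}$ then $V_{i_1}=V_{i_2}$; (3) every $i\in[n]$ lies in at least $\delta n$ sets of $\mathcal{S}$; (4) every pair $\{i_1,i_2\}$, $i_1\neq i_2$, lies together in at most $\alpha$ sets of $\mathcal{S}$. *)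

theory Defs
  imports "HOL-Analysis.Analysis" "HOL-Library.Set_Algebras"
begin

definition separated :: "real \<Rightarrow> 'a::real_inner set \<Rightarrow> 'a set \<Rightarrow> bool" where
  "separated \<tau> V V' \<longleftrightarrow>
     (\<forall>u\<in>V. \<forall>u'\<in>V'. norm u = 1 \<longrightarrow> norm u' = 1 \<longrightarrow> \<bar>u \<bullet> u'\<bar> \<le> 1 - \<tau>)"

text \<open>
  The list of spaces is V 1, ..., V n and the list of sets is S 1, ..., S w, which may
  contain repetitions; the last two conditions therefore count positions j in the list.
  The sum of two subspaces is the elementwise sum of sets.
\<close>

definition ad_system ::
  "nat \<Rightarrow> real \<Rightarrow> nat \<Rightarrow> (nat \<Rightarrow> 'a::real_vector set) \<Rightarrow> nat \<Rightarrow> (nat \<Rightarrow> nat set) \<Rightarrow> bool" where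
  "ad_system \<alpha> \<delta> n V w S \<longleftrightarrow>
     \<alpha> \<ge> 1 \<and> \<delta> > 0 \<and>
     (\<forall>j\<in>{1..w}. S j \<subseteq> {1..n} \<and> (card (S j) = 3 \<or> card (S j) = 2)) \<and>
     (\<forall>j\<in>{1..w}. \<forall>i1 i2 i3. card (S j) = 3 \<and> S j = {i1, i2, i3} \<longrightarrow>
        V i1 \<subseteq> V i2 + V i3 \<and> V i2 \<subseteq> V i1 + V i3 \<and> V i3 \<subseteq> V i1 + V i2) \<and>
     (\<forall>j\<in>{1..w}. \<forall>i1 i2. card (S j) = 2 \<and> S j = {i1, i2} \<longrightarrow> V i1 = V i2) \<and>
     (\<forall>i\<in>{1..n}. real (card {j\<in>{1..w}. i \<in> S j}) \<ge> \<delta> * real n) \<and>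
     (\<forall>i1\<in>{1..n}. \<forall>i2\<in>{1..n}. i1 \<noteq> i2 \<longrightarrow> card {j\<in>{1..w}. {i1, i2} \<subseteq> S j} \<le> \<alpha>)"

end

theory Submission
  imports Defs
begin

text \<open>
  Let \<open>P\<^sub>i\<close> be the orthogonal projection onto \<open>V\<^sub>i\<close>, let \<open>W\<close> be the sum of all \<open>V\<^sub>i\<close>, and let \<open>R\<close> be
  the inverse of \<open>T = \<Sum>i. P\<^sub>i\<close> on \<open>W\<close>. Taking traces in \<open>T R = id\<close> shows that \<open>dim W\<close> is the sum of
  \<open>x \<bullet> R x\<close> over all \<open>i\<close> and all \<open>x\<close> in an orthonormal basis of \<open>V\<^sub>i\<close>. By Cauchy-Schwarz,
  \<open>x \<bullet> R x \<le> (\<Sum>b. \<bar>g\<^sub>b\<bar>\<^sup>2)\<close> for every decomposition \<open>x = (\<Sum>b. g\<^sub>b)\<close> with \<open>g\<^sub>b \<in> V\<^sub>b\<close>. Each set of the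
  system through \<open>i\<close> decomposes \<open>x\<close> into two vectors, and separation bounds their squared norms
  by \<open>\<bar>x\<bar>\<^sup>2 / \<tau>\<close>. The average of these at least \<open>\<delta> n\<close> decompositions has cost at most
  \<open>\<alpha> / (\<tau> \<delta> n)\<close>, because at most \<open>\<alpha>\<close> of them share a given \<open>V\<^sub>b\<close>.
\<close>

section \<open>Linear algebra: frame operators and the dimension of a sum of subspaces\<close>

lemma frame_operator_inverse:
  fixes f :: "'c \<Rightarrow> 'a::euclidean_space"
  assumes C: "finite C"
  obtains R where "linear R"
    and "\<And>u. u \<in> span (f ` C) \<Longrightarrow> (\<Sum>c\<in>C. (f c \<bullet> R u) *\<^sub>R f c) = u"
    and "real (dim (span (f ` C))) = (\<Sum>c\<in>C. f c \<bullet> R (f c))"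
proof -
  define W where "W = span (f ` C)"
  define T where "T v = (\<Sum>c\<in>C. (f c \<bullet> v) *\<^sub>R f c)" for v
  have W: "subspace W" unfolding W_def by simp
  have fW: "f c \<in> W" if "c \<in> C" for c
    unfolding W_def using that by (simp add: span_base)
  have lin: "linear T"
    unfolding T_def
    by (intro linearI) (simp_all add: inner_add_right scaleR_add_left sum.distrib scaleR_sum_right)
  have TW: "T ` W \<subseteq> W"
    unfolding T_def using W fW by (auto intro!: subspace_sum subspace_scale)
  \<comment> \<open>Pairing \<open>T v\<close> with \<open>v\<close> gives a sum of squares, so
    \<open>T v = 0\<close> makes \<open>v\<close> orthogonal to every generator of \<open>W\<close>,
    hence to \<open>v\<close> itself.\<close>
  have inj: "inj_on T W"
    unfolding linear_inj_on_iff_eq_0[OF lin W]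
  proof (intro ballI impI)
    fix v assume v: "v \<in> W" "T v = 0"
    have "(\<Sum>c\<in>C. (f c \<bullet> v)\<^sup>2) = T v \<bullet> v"
      unfolding T_def by (simp add: inner_sum_left power2_eq_square)
    then have "\<forall>c\<in>C. (f c \<bullet> v)\<^sup>2 = 0"
      using v C by (simp add: sum_nonneg_eq_0_iff)
    then have "\<And>y. y \<in> f ` C \<Longrightarrow> orthogonal v y"
      by (auto simp: orthogonal_def inner_commute)
    from orthogonal_to_span[OF v(1)[unfolded W_def] this] show "v = 0"
      by (simp add: orthogonal_def)
  qed
  have surj: "T ` W = W"
    by (rule subspace_dim_equal)
       (use W TW lin inj in \<open>auto simp: linear_subspace_image span_eq_iff[THEN iffD2] dim_image_eq\<close>)
  obtain R where R: "linear R" "\<And>v. v \<in> W \<Longrightarrow> R (T v) = v"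
    using linear_exists_left_inverse_on[OF lin W inj] by blast
  have TR: "T (R u) = u" if "u \<in> W" for u
    using that surj R(2) by (metis imageE)
  obtain E where E: "E \<subseteq> W" "pairwise orthogonal E" "\<And>x. x \<in> E \<Longrightarrow> norm x = 1"
      "independent E" "card E = dim W" "span E = W"
    using orthonormal_basis_subspace[OF W] by metis
  have finE: "finite E" using E(4) independent_imp_finite by blast
  have expand: "(\<Sum>e\<in>E. (x \<bullet> e) *\<^sub>R e) = x" if "x \<in> W" for x
    using orthonormal_basis_expand[OF E(2) E(3) _ finE] that E(6) by blast
  \<comment> \<open>The trace of the identity of \<open>W\<close> in the orthonormal basis
    \<open>E\<close>, rewritten as the trace of \<open>T\<close> after \<open>R\<close>. Swapping
    the sums and recombining the expansion of \<open>f c\<close> in \<open>E\<close> removes the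
    basis again.\<close>
  have "real (dim W) = (\<Sum>e\<in>E. e \<bullet> e)"
    using E(3,5) by (simp add: dot_square_norm)
  also have "\<dots> = (\<Sum>e\<in>E. T (R e) \<bullet> e)"
    using TR E(1) by (intro sum.cong) auto
  also have "\<dots> = (\<Sum>e\<in>E. \<Sum>c\<in>C. (f c \<bullet> R e) * (f c \<bullet> e))"
    unfolding T_def by (simp add: inner_sum_left)
  also have "\<dots> = (\<Sum>c\<in>C. \<Sum>e\<in>E. (f c \<bullet> R e) * (f c \<bullet> e))"
    by (rule sum.swap)
  also have "\<dots> = (\<Sum>c\<in>C. f c \<bullet> R (\<Sum>e\<in>E. (f c \<bullet> e) *\<^sub>R e))"
    by (simp add: linear_sum[OF R(1)] linear_cmul[OF R(1)] inner_sum_right mult.commute)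
  also have "\<dots> = (\<Sum>c\<in>C. f c \<bullet> R (f c))"
    using expand fW by (intro sum.cong) auto
  finally have "real (dim W) = (\<Sum>c\<in>C. f c \<bullet> R (f c))" .
  then show ?thesis
    using that R(1) TR unfolding W_def T_def by blast
qed

text \<open>Here \<open>q i\<close> is the squared length of the projection of \<open>y\<close> onto
  \<open>span (B i)\<close>. Coordinatewise, \<open>2 * s * t\<close> is at most the sum of the
  squares of \<open>s\<close> and \<open>t\<close>, so \<open>g i \<bullet> y\<close> is at most
  half the sum of the squared norm of \<open>g i\<close> and \<open>q i\<close>.\<close>

lemma frame_decomposition_bound:
  fixes B :: "'i \<Rightarrow> 'a::euclidean_space set"
  assumes fin: "finite I" "\<And>i. i \<in> I \<Longrightarrow> finite (B i)"
    and orth: "\<And>i. i \<in> I \<Longrightarrow> pairwise orthogonal (B i)"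
    and unit: "\<And>i x. i \<in> I \<Longrightarrow> x \<in> B i \<Longrightarrow> norm x = 1"
    and g: "\<And>i. i \<in> I \<Longrightarrow> g i \<in> span (B i)"
    and sum_g: "(\<Sum>i\<in>I. g i) = (\<Sum>i\<in>I. \<Sum>x\<in>B i. (x \<bullet> y) *\<^sub>R x)"
  shows "(\<Sum>i\<in>I. g i) \<bullet> y \<le> (\<Sum>i\<in>I. (norm (g i))\<^sup>2)"
proof -
  define q where "q i = (\<Sum>x\<in>B i. (x \<bullet> y)\<^sup>2)" for i
  have q0: "q i \<ge> 0" for i unfolding q_def by (simp add: sum_nonneg)
  have gq: "g i \<bullet> y \<le> ((norm (g i))\<^sup>2 + q i) / 2" if i: "i \<in> I" for i
  proof -
    have ex: "(\<Sum>x\<in>B i. (g i \<bullet> x) *\<^sub>R x) = g i"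
      using orthonormal_basis_expand[OF orth[OF i] unit[OF i] g[OF i] fin(2)[OF i]] by simp
    have "g i \<bullet> y = (\<Sum>x\<in>B i. (g i \<bullet> x) *\<^sub>R x) \<bullet> y" using ex by simp
    then have gy: "g i \<bullet> y = (\<Sum>x\<in>B i. (g i \<bullet> x) * (x \<bullet> y))"
      by (simp add: inner_sum_left)
    have "(norm (g i))\<^sup>2 = (\<Sum>x\<in>B i. (g i \<bullet> x) *\<^sub>R x) \<bullet> g i"
      using ex by (simp add: power2_norm_eq_inner)
    also have "\<dots> = (\<Sum>x\<in>B i. (g i \<bullet> x)\<^sup>2)"
      unfolding inner_sum_left by (simp add: power2_eq_square inner_commute)
    finally have "(norm (g i))\<^sup>2 + q i = (\<Sum>x\<in>B i. (g i \<bullet> x)\<^sup>2 + (x \<bullet> y)\<^sup>2)"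
      by (simp add: q_def sum.distrib)
    also have "\<dots> \<ge> (\<Sum>x\<in>B i. 2 * ((g i \<bullet> x) * (x \<bullet> y)))"
      using sum_squares_bound by (intro sum_mono) (simp add: mult.assoc)
    finally show ?thesis using gy by (simp add: sum_distrib_left[symmetric])
  qed
  \<comment> \<open>By \<open>sum_g\<close> the numbers \<open>q i\<close> add up to the very
    quantity being bounded, so half of it is absorbed into the left-hand side.\<close>
  have "(\<Sum>i\<in>I. g i) \<bullet> y = (\<Sum>i\<in>I. q i)"
    unfolding sum_g q_def by (simp add: inner_sum_left power2_eq_square)
  moreover have "(\<Sum>i\<in>I. g i) \<bullet> y \<le> (\<Sum>i\<in>I. ((norm (g i))\<^sup>2 + q i) / 2)"
    unfolding inner_sum_left by (intro sum_mono gq)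
  ultimately show ?thesis
    by (simp add: sum.distrib sum_divide_distrib[symmetric])
qed

text \<open>The trace formula, applied to orthonormal bases of all the \<open>V i\<close> together,
  writes the dimension as a sum of at most \<open>card I * k\<close> terms
  \<open>x \<bullet> R x\<close>. A cheap decomposition of \<open>x\<close> bounds each of them by
  \<open>c\<close>.\<close>

lemma dim_le_of_decompositions:
  fixes V :: "'i \<Rightarrow> 'a::euclidean_space set"
  assumes I: "finite I"
    and sub: "\<And>i. i \<in> I \<Longrightarrow> subspace (V i)"
    and dimV: "\<And>i. i \<in> I \<Longrightarrow> dim (V i) \<le> k"
    and dec: "\<And>a x. a \<in> I \<Longrightarrow> x \<in> V a \<Longrightarrow> norm x = 1 \<Longrightarrow>
      \<exists>g. (\<forall>b\<in>I. g b \<in> V b) \<and> (\<Sum>b\<in>I. g b) = x \<and> (\<Sum>b\<in>I. (norm (g b))\<^sup>2) \<le> c"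
    and c: "c \<ge> 0"
  shows "real (dim (\<Sum>i\<in>I. V i)) \<le> real (card I) * real k * c"
proof -
  have "\<forall>i\<in>I. \<exists>B. finite B \<and> B \<subseteq> V i \<and> pairwise orthogonal B \<and> (\<forall>x\<in>B. norm x = 1) \<and>
      card B = dim (V i) \<and> span B = V i"
    using orthonormal_basis_subspace[OF sub] independent_imp_finite by metis
  then obtain B where B: "\<And>i. i \<in> I \<Longrightarrow> finite (B i) \<and> B i \<subseteq> V i \<and> pairwise orthogonal (B i) \<and>
      (\<forall>x\<in>B i. norm x = 1) \<and> card (B i) = dim (V i) \<and> span (B i) = V i"
    by metis
  \<comment> \<open>The disjoint union counts a vector once for every basis that contains it, as the
    sum of the projections requires.\<close>
  define C where "C = Sigma I B"
  have finC: "finite C" unfolding C_def using I B by blast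
  have sumC: "(\<Sum>c\<in>C. F (snd c)) = (\<Sum>i\<in>I. \<Sum>x\<in>B i. F x)" for F :: "'a \<Rightarrow> 'b::comm_monoid_add"
    unfolding C_def using I B by (subst sum.Sigma) (auto intro!: sum.cong)
  obtain R where R: "linear R"
    "\<And>u. u \<in> span (snd ` C) \<Longrightarrow> (\<Sum>c\<in>C. (snd c \<bullet> R u) *\<^sub>R snd c) = u"
    "real (dim (span (snd ` C))) = (\<Sum>c\<in>C. snd c \<bullet> R (snd c))"
    using frame_operator_inverse[OF finC, of snd] by blast
  \<comment> \<open>The vector \<open>R x\<close> plays the role of \<open>y\<close>: that the frame
    operator sends it to \<open>x\<close> is exactly the hypothesis \<open>sum_g\<close>.\<close>
  have le: "x \<bullet> R x \<le> c" if a: "a \<in> I" and x: "x \<in> B a" for a x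
  proof -
    have "x \<in> V a" "norm x = 1" using B a x by auto
    from dec[OF a this] obtain g where g: "\<forall>b\<in>I. g b \<in> V b" "(\<Sum>b\<in>I. g b) = x"
      "(\<Sum>b\<in>I. (norm (g b))\<^sup>2) \<le> c" by blast
    have "x \<in> span (snd ` C)"
      using a x by (force simp: C_def intro: span_base)
    from R(2)[OF this] have "(\<Sum>i\<in>I. \<Sum>z\<in>B i. (z \<bullet> R x) *\<^sub>R z) = x"
      using sumC[of "\<lambda>z. (z \<bullet> R x) *\<^sub>R z"] by simp
    with g have "(\<Sum>b\<in>I. g b) \<bullet> R x \<le> (\<Sum>b\<in>I. (norm (g b))\<^sup>2)"
      using B I by (intro frame_decomposition_bound[where B=B]) auto
    then show ?thesis using g by simp
  qed
  have "(\<Sum>i\<in>I. V i) \<subseteq> span (snd ` C)"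
  proof
    fix y assume "y \<in> (\<Sum>i\<in>I. V i)"
    then obtain s where s: "y = sum s I" "\<And>i. i \<in> I \<Longrightarrow> s i \<in> V i"
      unfolding set_sum_alt[OF I] by blast
    have "span (B i) \<subseteq> span (snd ` C)" if "i \<in> I" for i
      using that by (intro span_mono) (force simp: C_def)
    then show "y \<in> span (snd ` C)"
      using s B unfolding s(1) by (intro span_sum) blast
  qed
  then have "real (dim (\<Sum>i\<in>I. V i)) \<le> real (dim (span (snd ` C)))"
    using dim_subset by (simp del: dim_span)
  also have "\<dots> = (\<Sum>i\<in>I. \<Sum>x\<in>B i. x \<bullet> R x)"
    unfolding R(3) by (rule sumC)
  also have "\<dots> \<le> (\<Sum>i\<in>I. real k * c)"
  proof (intro sum_mono)
    fix i assume i: "i \<in> I"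
    have "(\<Sum>x\<in>B i. x \<bullet> R x) \<le> real (card (B i)) * c"
      using le[OF i] by (rule sum_bounded_above)
    also have "\<dots> \<le> real k * c"
      using B[OF i] dimV[OF i] c by (intro mult_right_mono) auto
    finally show "(\<Sum>x\<in>B i. x \<bullet> R x) \<le> real k * c" .
  qed
  finally show ?thesis by simp
qed

section \<open>Norm estimates for separated subspaces\<close>

lemma separated_abs_inner_le:
  fixes V V' :: "'a::real_inner set"
  assumes sep: "separated \<tau> V V'" and sub: "subspace V" "subspace V'"
    and u: "u \<in> V" and v: "v \<in> V'"
  shows "\<bar>u \<bullet> v\<bar> \<le> (1 - \<tau>) * (norm u * norm v)"
proof (cases "u = 0 \<or> v = 0")
  case False
  have "u /\<^sub>R norm u \<in> V" "v /\<^sub>R norm v \<in> V'"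
    using sub u v by (simp_all add: subspace_scale)
  moreover have "norm (u /\<^sub>R norm u) = 1" "norm (v /\<^sub>R norm v) = 1"
    using False by simp_all
  ultimately have "\<bar>(u /\<^sub>R norm u) \<bullet> (v /\<^sub>R norm v)\<bar> \<le> 1 - \<tau>"
    using sep unfolding separated_def by blast
  then show ?thesis using False
    by (simp add: abs_mult field_simps)
qed auto

text \<open>The cross term \<open>2 * (u \<bullet> v)\<close> is at least
  \<open>- (1 - \<tau>) * (2 * (norm u * norm v))\<close>, and the product of the norms is absorbed
  by their squares because \<open>1 - \<tau>\<close> is nonnegative.\<close>

lemma separated_sum_norm_squares_le:
  fixes V V' :: "'a::real_inner set"
  assumes sep: "separated \<tau> V V'" and sub: "subspace V" "subspace V'"
    and \<tau>: "\<tau> \<le> 1" and u: "u \<in> V" and v: "v \<in> V'"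
  shows "\<tau> * ((norm u)\<^sup>2 + (norm v)\<^sup>2) \<le> (norm (u + v))\<^sup>2"
proof -
  have "(norm (u + v))\<^sup>2 = (norm u)\<^sup>2 + (norm v)\<^sup>2 + 2 * (u \<bullet> v)"
    by (simp add: power2_norm_eq_inner inner_add_left inner_add_right inner_commute)
  moreover have "(1 - \<tau>) * (2 * (norm u * norm v)) \<le> (1 - \<tau>) * ((norm u)\<^sup>2 + (norm v)\<^sup>2)"
    using \<tau> sum_squares_bound[of "norm u" "norm v"] by (intro mult_left_mono) auto
  ultimately show ?thesis
    using separated_abs_inner_le[OF sep sub u v] by (simp add: algebra_simps abs_le_iff)
qed

section \<open>Decompositions of unit vectors supplied by the system\<close>

lemma ad_systemD:
  assumes "ad_system \<alpha> \<delta> n V w S"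
  shows "\<delta> > 0"
    and "j \<in> {1..w} \<Longrightarrow> S j \<subseteq> {1..n}"
    and "j \<in> {1..w} \<Longrightarrow> card (S j) = 3 \<or> card (S j) = 2"
    and "j \<in> {1..w} \<Longrightarrow> card (S j) = 3 \<Longrightarrow> S j = {i1, i2, i3} \<Longrightarrow> V i1 \<subseteq> V i2 + V i3"
    and "j \<in> {1..w} \<Longrightarrow> card (S j) = 2 \<Longrightarrow> S j = {i1, i2} \<Longrightarrow> V i1 = V i2"
    and "i \<in> {1..n} \<Longrightarrow> \<delta> * real n \<le> real (card {j\<in>{1..w}. i \<in> S j})"
    and "i1 \<in> {1..n} \<Longrightarrow> i2 \<in> {1..n} \<Longrightarrow> i1 \<noteq> i2 \<Longrightarrow> card {j\<in>{1..w}. {i1, i2} \<subseteq> S j} \<le> \<alpha>"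
  using assms unfolding ad_system_def by meson+

text \<open>A triple through \<open>a\<close> splits \<open>x\<close> between the two other spaces.
  The support condition on \<open>h\<close> is recorded so that the pairs \<open>{a, b}\<close> can
  later be counted.\<close>

lemma ad_system_set_decomposition:
  fixes V :: "nat \<Rightarrow> 'a::real_inner set"
  assumes sys: "ad_system \<alpha> \<delta> n V w S"
    and sub: "\<And>i. i \<in> {1..n} \<Longrightarrow> subspace (V i)"
    and \<tau>: "\<tau> > 0"
    and sep: "\<And>i1 i2. i1 \<noteq> i2 \<Longrightarrow> {i1, i2} \<subseteq> S j \<Longrightarrow> separated \<tau> (V i1) (V i2)"
    and j: "j \<in> {1..w}" and a: "a \<in> S j" and x: "x \<in> V a" "norm x = 1"
  shows "\<exists>h. (\<forall>b\<in>{1..n}. h b \<in> V b) \<and> (\<forall>b. b \<notin> S j - {a} \<longrightarrow> h b = 0) \<and>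
    (\<Sum>b=1..n. h b) = x \<and> (\<Sum>b=1..n. (norm (h b))\<^sup>2) \<le> 1 / \<tau>"
proof -
  have Sn: "S j \<subseteq> {1..n}" and card: "card (S j) = 3 \<or> card (S j) = 2"
    using ad_systemD(2,3)[OF sys j] by auto
  have subS: "subspace (V i)" if "i \<in> S j" for i using that Sn sub by blast
  from card show ?thesis
  proof
    assume c2: "card (S j) = 2"
    then obtain b where b: "S j = {a, b}" "a \<noteq> b"
      using a by (metis card_2_iff insert_commute insert_iff singletonD)
    then have "V a = V b"
      using ad_systemD(5)[OF sys j c2] by blast
    then have "separated \<tau> (V a) (V a)" using sep[of a b] b by simp
    \<comment> \<open>Sets of size two are contradictory here: the unit vector \<open>x\<close> lies
      in both equal spaces, which would give \<open>1 \<le> 1 - \<tau>\<close>.\<close>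
    then have "\<bar>x \<bullet> x\<bar> \<le> 1 - \<tau>" using x unfolding separated_def by blast
    then show ?thesis using x \<tau> by (simp add: dot_square_norm)
  next
    assume c3: "card (S j) = 3"
    then have "card (S j - {a}) = 2" using a by simp
    then obtain b c where "S j - {a} = {b, c}" "b \<noteq> c"
      unfolding card_2_iff by blast
    then have bc: "S j = {a, b, c}" "a \<noteq> b" "a \<noteq> c" "b \<noteq> c"
      using a by blast+
    have "V a \<subseteq> V b + V c"
      using ad_systemD(4)[OF sys j c3 bc(1)] .
    then obtain u v where uv: "x = u + v" "u \<in> V b" "v \<in> V c"
      using x by (auto elim!: set_plus_elim)
    \<comment> \<open>The bound on \<open>\<tau>\<close> comes from a nonzero vector in
      \<open>V b\<close> or \<open>V c\<close> tested against \<open>x\<close>; such a vector exists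
      because \<open>u\<close> and \<open>v\<close> do not both vanish.\<close>
    have nz: "\<tau> \<le> 1" if z: "i \<in> {b, c}" "y \<in> V i" "y \<noteq> 0" for i y
    proof -
      have "separated \<tau> (V a) (V i)" using sep[of a i] z bc by auto
      from separated_abs_inner_le[OF this _ _ x(1) z(2)]
      have "0 \<le> (1 - \<tau>) * norm y" using subS bc z x by fastforce
      then show ?thesis using z by (simp add: zero_le_mult_iff)
    qed
    have "u \<noteq> 0 \<or> v \<noteq> 0" using uv x by auto
    then have "\<tau> \<le> 1" using nz uv by blast
    then have "\<tau> * ((norm u)\<^sup>2 + (norm v)\<^sup>2) \<le> (norm (u + v))\<^sup>2"
      using separated_sum_norm_squares_le[OF sep[of b c]] bc uv subS by auto
    then have le: "(norm u)\<^sup>2 + (norm v)\<^sup>2 \<le> 1 / \<tau>"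
      using \<tau> x uv by (simp add: field_simps)
    define h where "h = (\<lambda>i. 0)(b := u, c := v)"
    have sum_h: "(\<Sum>i=1..n. F (h i)) = F u + F v" if "F 0 = 0"
      for F :: "'a \<Rightarrow> 'b::comm_monoid_add"
    proof -
      have "(\<Sum>i=1..n. F (h i)) = (\<Sum>i\<in>{b, c}. F (h i))"
        using Sn bc that by (intro sum.mono_neutral_right) (auto simp: h_def)
      then show ?thesis using bc by (simp add: h_def)
    qed
    have "h i \<in> V i" if "i \<in> {1..n}" for i
      using uv sub[OF that] by (simp add: h_def subspace_0)
    moreover have "h i = 0" if "i \<notin> S j - {a}" for i
      using that bc by (auto simp: h_def)
    moreover have "(\<Sum>i=1..n. h i) = x"
      using sum_h[of "\<lambda>y. y"] uv by simp
    moreover have "(\<Sum>i=1..n. (norm (h i))\<^sup>2) \<le> 1 / \<tau>"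
      using sum_h[of "\<lambda>y. (norm y)\<^sup>2"] le by simp
    ultimately show ?thesis by blast
  qed
qed

lemma norm_sum_squared_le:
  fixes f :: "'i \<Rightarrow> 'a::real_normed_vector"
  shows "(norm (\<Sum>i\<in>A. f i))\<^sup>2 \<le> real (card A) * (\<Sum>i\<in>A. (norm (f i))\<^sup>2)"
proof -
  have "(norm (\<Sum>i\<in>A. f i))\<^sup>2 \<le> (\<Sum>i\<in>A. 1 * norm (f i))\<^sup>2"
    by (intro power_mono) (simp_all add: norm_sum)
  also have "\<dots> \<le> (\<Sum>i\<in>A. 1\<^sup>2) * (\<Sum>i\<in>A. (norm (f i))\<^sup>2)"
    by (rule Cauchy_Schwarz_ineq_sum)
  finally show ?thesis by simp
qed

text \<open>Average the decompositions given by the \<open>L\<close> sets through \<open>a\<close>.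
  At each \<open>b\<close> at most \<alpha> of them are nonzero, so Cauchy-Schwarz loses a factor
  \<alpha> rather than \<open>L\<close>, and the total cost is at most
  \<open>\<alpha> / L\<^sup>2 * (L / \<tau>)\<close>.\<close>

lemma ad_system_decomposition:
  fixes V :: "nat \<Rightarrow> 'a::real_inner set"
  assumes sys: "ad_system \<alpha> \<delta> n V w S"
    and sub: "\<And>i. i \<in> {1..n} \<Longrightarrow> subspace (V i)"
    and \<tau>: "\<tau> > 0"
    and sep: "\<And>j i1 i2. j \<in> {1..w} \<Longrightarrow> i1 \<noteq> i2 \<Longrightarrow> {i1, i2} \<subseteq> S j \<Longrightarrow> separated \<tau> (V i1) (V i2)"
    and a: "a \<in> {1..n}" and x: "x \<in> V a" "norm x = 1"
  shows "\<exists>g. (\<forall>b\<in>{1..n}. g b \<in> V b) \<and> (\<Sum>b=1..n. g b) = x \<and>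
    (\<Sum>b=1..n. (norm (g b))\<^sup>2) \<le> real \<alpha> / (\<tau> * \<delta> * real n)"
proof -
  define J where "J = {j\<in>{1..w}. a \<in> S j}"
  define L where "L = real (card J)"
  have \<delta>: "\<delta> > 0" and L: "L \<ge> \<delta> * real n"
    using ad_systemD(1,6)[OF sys] a unfolding J_def L_def by auto
  \<comment> \<open>The index \<open>a\<close> witnesses that \<open>n\<close> is positive, so some
    set passes through \<open>a\<close> and dividing by \<open>L\<close> is legitimate.\<close>
  have \<delta>n: "\<delta> * real n > 0" using \<delta> a by simp
  have L0: "L > 0" using L \<delta>n by linarith
  have finJ: "finite J" unfolding J_def by simp
  have "\<forall>j\<in>J. \<exists>h. (\<forall>b\<in>{1..n}. h b \<in> V b) \<and> (\<forall>b. b \<notin> S j - {a} \<longrightarrow> h b = 0) \<and>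
    (\<Sum>b=1..n. h b) = x \<and> (\<Sum>b=1..n. (norm (h b))\<^sup>2) \<le> 1 / \<tau>"
  proof
    fix j assume "j \<in> J"
    then show "\<exists>h. (\<forall>b\<in>{1..n}. h b \<in> V b) \<and> (\<forall>b. b \<notin> S j - {a} \<longrightarrow> h b = 0) \<and>
      (\<Sum>b=1..n. h b) = x \<and> (\<Sum>b=1..n. (norm (h b))\<^sup>2) \<le> 1 / \<tau>"
      using sep x by (intro ad_system_set_decomposition[OF sys sub \<tau>]) (auto simp: J_def)
  qed
  then obtain h where h: "\<And>j b. j \<in> J \<Longrightarrow> b \<in> {1..n} \<Longrightarrow> h j b \<in> V b"
    "\<And>j b. j \<in> J \<Longrightarrow> b \<notin> S j - {a} \<Longrightarrow> h j b = 0"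
    "\<And>j. j \<in> J \<Longrightarrow> (\<Sum>b=1..n. h j b) = x"
    "\<And>j. j \<in> J \<Longrightarrow> (\<Sum>b=1..n. (norm (h j b))\<^sup>2) \<le> 1 / \<tau>"
    by metis
  define g where "g b = (1 / L) *\<^sub>R (\<Sum>j\<in>J. h j b)" for b
  have "g b \<in> V b" if "b \<in> {1..n}" for b
    unfolding g_def using sub[OF that] h(1) that by (intro subspace_scale subspace_sum) auto
  moreover have "(\<Sum>b=1..n. g b) = x"
  proof -
    have "(\<Sum>b=1..n. g b) = (1 / L) *\<^sub>R (\<Sum>b=1..n. \<Sum>j\<in>J. h j b)"
      unfolding g_def by (rule scaleR_sum_right[symmetric])
    also have "(\<Sum>b=1..n. \<Sum>j\<in>J. h j b) = (\<Sum>j\<in>J. \<Sum>b=1..n. h j b)"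
      by (rule sum.swap)
    also have "\<dots> = (\<Sum>j\<in>J. x)" using h(3) by (intro sum.cong) auto
    also have "\<dots> = L *\<^sub>R x" by (simp add: L_def sum_constant_scaleR)
    finally show ?thesis using L0 by simp
  qed
  moreover have "(\<Sum>b=1..n. (norm (g b))\<^sup>2) \<le> real \<alpha> / (\<tau> * \<delta> * real n)"
  proof -
    have gb: "(norm (g b))\<^sup>2 \<le> real \<alpha> / L\<^sup>2 * (\<Sum>j\<in>J. (norm (h j b))\<^sup>2)" if b: "b \<in> {1..n}" for b
    proof -
      \<comment> \<open>The sets whose decomposition may use \<open>V b\<close>: none if
        \<open>b = a\<close>, otherwise those containing the pair \<open>{a, b}\<close>.\<close>
      define K where "K = {j\<in>J. b \<in> S j - {a}}"
      have K: "K \<subseteq> J" unfolding K_def by blast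
      have "card K \<le> \<alpha>"
      proof (cases "b = a")
        case False
        then have "card {j\<in>{1..w}. {a, b} \<subseteq> S j} \<le> \<alpha>"
          using ad_systemD(7)[OF sys a b] by simp
        moreover have "K = {j\<in>{1..w}. {a, b} \<subseteq> S j}"
          using False by (auto simp: K_def J_def)
        ultimately show ?thesis by simp
      qed (simp add: K_def)
      have "(\<Sum>j\<in>J. h j b) = (\<Sum>j\<in>K. h j b)"
        using finJ K h(2) by (intro sum.mono_neutral_right) (auto simp: K_def)
      then have "(norm (\<Sum>j\<in>J. h j b))\<^sup>2 \<le> real (card K) * (\<Sum>j\<in>K. (norm (h j b))\<^sup>2)"
        using norm_sum_squared_le by metis
      also have "\<dots> \<le> real \<alpha> * (\<Sum>j\<in>J. (norm (h j b))\<^sup>2)"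
        using \<open>card K \<le> \<alpha>\<close> finJ K by (intro mult_mono sum_mono2) (auto simp: sum_nonneg)
      finally have "(norm (\<Sum>j\<in>J. h j b))\<^sup>2 \<le> real \<alpha> * (\<Sum>j\<in>J. (norm (h j b))\<^sup>2)" .
      then have "(norm (\<Sum>j\<in>J. h j b))\<^sup>2 / L\<^sup>2 \<le> real \<alpha> * (\<Sum>j\<in>J. (norm (h j b))\<^sup>2) / L\<^sup>2"
        by (rule divide_right_mono) simp
      then show ?thesis by (simp add: g_def power_divide)
    qed
    have "(\<Sum>b=1..n. (norm (g b))\<^sup>2) \<le> (\<Sum>b=1..n. real \<alpha> / L\<^sup>2 * (\<Sum>j\<in>J. (norm (h j b))\<^sup>2))"
      by (intro sum_mono gb)
    also have "\<dots> = real \<alpha> / L\<^sup>2 * (\<Sum>j\<in>J. \<Sum>b=1..n. (norm (h j b))\<^sup>2)"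
      by (subst sum.swap) (rule sum_distrib_left[symmetric])
    also have "\<dots> \<le> real \<alpha> / L\<^sup>2 * (L * (1 / \<tau>))"
    proof (intro mult_left_mono)
      show "(\<Sum>j\<in>J. \<Sum>b=1..n. (norm (h j b))\<^sup>2) \<le> L * (1 / \<tau>)"
        unfolding L_def using h(4) by (rule sum_bounded_above)
    qed simp
    also have "\<dots> = real \<alpha> / (\<tau> * L)"
      using L0 by (simp add: power2_eq_square)
    also have "\<dots> \<le> real \<alpha> / (\<tau> * (\<delta> * real n))"
      using L \<tau> \<delta> a L0 by (intro divide_left_mono mult_left_mono mult_pos_pos) auto
    finally show ?thesis by (simp add: mult.assoc)
  qed
  ultimately show ?thesis by blast
qed

theorem theorem28:
  fixes V :: "nat \<Rightarrow> (real ^ 'l) set"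
    and S :: "nat \<Rightarrow> nat set"
    and n w k \<alpha> d :: nat
    and \<delta> \<tau> :: real
  assumes "\<And>i. i \<in> {1..n} \<Longrightarrow> subspace (V i)"
    and "\<And>i. i \<in> {1..n} \<Longrightarrow> dim (V i) \<le> k"
    and "ad_system \<alpha> \<delta> n V w S"
    and "\<tau> > 0"
    and "d = dim (\<Sum>i=1..n. V i)"
    and "\<And>j i1 i2. j \<in> {1..w} \<Longrightarrow> i1 \<noteq> i2 \<Longrightarrow> {i1, i2} \<subseteq> S j \<Longrightarrow> separated \<tau> (V i1) (V i2)"
  shows "real d \<le> real \<alpha> * real k / (\<tau> * \<delta>)"
proof -
  have \<delta>: "\<delta> > 0" by (rule ad_systemD(1)[OF assms(3)])
  have "real d \<le> real (card {1..n}) * real k * (real \<alpha> / (\<tau> * \<delta> * real n))"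
    unfolding assms(5)
  proof (rule dim_le_of_decompositions)
    show "\<exists>g. (\<forall>b\<in>{1..n}. g b \<in> V b) \<and> (\<Sum>b=1..n. g b) = x \<and>
        (\<Sum>b=1..n. (norm (g b))\<^sup>2) \<le> real \<alpha> / (\<tau> * \<delta> * real n)"
      if "a \<in> {1..n}" "x \<in> V a" "norm x = 1" for a x
      by (rule ad_system_decomposition) (fact assms that)+
  qed (use assms(1,2,4) \<delta> in auto)
  \<comment> \<open>The number \<open>n\<close> of spaces cancels the \<open>n\<close> in the cost
    of a decomposition; for \<open>n = 0\<close> the left-hand side is \<open>0\<close>.\<close>
  also have "\<dots> \<le> real \<alpha> * real k / (\<tau> * \<delta>)"
    using \<delta> assms(4) by (cases "n = 0") (auto simp: field_simps)
  finally show ?thesis .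
qed

end
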